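(* The map $\mathrm{Pr} : \mathcal{D} \to \mathcal{P}(\Sigma^\omega)$ is monotone and preserves least upper bounds and greatest lower bounds; that is, for definitive sets $X, Y$ and any family $(X_i)_{i\in I}$ of definitive sets: (1) if $X \subseteq Y$ then $\mathrm{Pr}(X) \subseteq \mathrm{Pr}(Y)$; (2) $\mathrm{Pr}(\bigcap_{i\in I} X_i) = \bigcap_{i \in I} \mathrm{Pr}(X_i)$; (3) $\mathrm{Pr}(\bigsqcup_{i\in I} X_i) = \bigcup_{i\in I} \mathrm{Pr}(X_i)$. Likewise, the map $\mathrm{Df} : \mathcal{P}(\Sigma^\omega) \to \mathcal{D}$ is monotone and preserves least upper bounds and greatest lower bounds; that is, for $P, Q \subseteq \Sigma^\omega$ and any family $(P_i)_{i \in I}$ of subsets of $\Sigma^\omega$: if $P \subseteq Q$ then $\mathrm{Df}(P) \subseteq \mathrm{Df}(Q)$; $\mathrm{Df}(\bigcap_{i\in I} P_i) = \bigcap_{i\in I}\mathrm{Df}(P_i)$; and $\mathrm{Df}(\bigcup_{i\in I} P_i) = \bigsqcup_{i\in I}\mathrm{Df}(P_i)$.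
   Context: Fix a set $A$ of atomic propositions and let $\Sigma = \mathcal{P}(A)$ be the set of states. $\Sigma^*$ is the set of finite traces (finite sequences of states, including the empty trace $\varepsilon$), $\Sigma^\omega$ the set of infinite traces, and $\Sigma^\infty = \Sigma^* \cup \Sigma^\omega$. Traces $t,u$ are concatenated as $tu$, with $tu = t$ if $t$ is infinite. For $X \subseteq \Sigma^\infty$, $\downarrow X = \{u \mid \exists t \in X.\ \exists v \in \Sigma^\infty.\ t = uv\}$ is the set of prefixes of traces in $X$; for a trace $t$, $\uparrow t = \{tu \mid u \in \Sigma^\infty\}$ is its set of extensions. The set of definitive prefixes of $X\subseteq\Sigma^\infty$ is $\mathrm{dp}(X) = \{t \in \Sigma^\infty \mid \uparrow t \subseteq \downarrow X\}$. A set $X \subseteq \Sigma^\infty$ is definitive iff $X = \mathrm{dp}(X)$; $\mathcal{D}$ denotes the set of all definitive sets, ordered by inclusion; it is a complete lattice with infimum given by intersection and supremum given by the definitive union $\bigsqcup_{i\in I} X_i = \mathrm{dp}(\bigcup_{i\in I} X_i)$. $\mathcal{P}(\Sigma^\omega)$ is ordered by inclusion. The maps are $\mathrm{Pr}(X) = X \cap \Sigma^\omega$ and $\mathrm{Df}(P) = \mathrm{dp}(P)$ (which is always definitive). An intersection over the empty family is the greatest element of the lattice in question: $\Sigma^\infty$ in $\mathcal{D}$ and $\Sigma^\omega$ in $\mathcal{P}(\Sigma^\omega)$. *)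

theory Defs
  imports "HOL-Library.FuncSet" "HOL-Library.Stream"
begin

text \<open>
  The set of atomic propositions is an explicit set \<open>A\<close> (possibly empty), so states are the
  elements of \<open>Pow A\<close>, and everything below is relativised to it.
\<close>

datatype 's trace = FinTr "'s list" | InfTr "'s stream"

type_synonym 'a state = "'a set"

definition fin_traces :: "'a set \<Rightarrow> 'a state trace set" where
  "fin_traces A = FinTr ` lists (Pow A)"

definition inf_traces :: "'a set \<Rightarrow> 'a state trace set" where
  "inf_traces A = InfTr ` streams (Pow A)"

definition traces :: "'a set \<Rightarrow> 'a state trace set" where
  "traces A = fin_traces A \<union> inf_traces A"

fun conc :: "'s trace \<Rightarrow> 's trace \<Rightarrow> 's trace" (infixr "\<cdot>" 65) where
  "FinTr xs \<cdot> FinTr ys = FinTr (xs @ ys)"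
| "FinTr xs \<cdot> InfTr s = InfTr (xs @- s)"
| "InfTr s \<cdot> u = InfTr s"

definition prefixes :: "'a set \<Rightarrow> 'a state trace set \<Rightarrow> 'a state trace set" where
  "prefixes A X = {u \<in> traces A. \<exists>t\<in>X. \<exists>v\<in>traces A. t = u \<cdot> v}"

definition extensions :: "'a set \<Rightarrow> 'a state trace \<Rightarrow> 'a state trace set" where
  "extensions A t = {t \<cdot> u | u. u \<in> traces A}"

definition dp :: "'a set \<Rightarrow> 'a state trace set \<Rightarrow> 'a state trace set" where
  "dp A X = {t \<in> traces A. extensions A t \<subseteq> prefixes A X}"

definition definitive_sets :: "'a set \<Rightarrow> 'a state trace set set" where
  "definitive_sets A = {X. X \<subseteq> traces A \<and> X = dp A X}"

definition definitive_Union :: "'a set \<Rightarrow> 'i set \<Rightarrow> ('i \<Rightarrow> 'a state trace set) \<Rightarrow> 'a state trace set" where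
  "definitive_Union A I X = dp A (\<Union>i\<in>I. X i)"

text \<open>
  Infima are taken in a lattice of subsets of \<open>U\<close>: the empty family has infimum \<open>U\<close>, not \<open>UNIV\<close>.
  If \<open>I\<close> is nonempty and all \<open>X i\<close> are subsets of \<open>U\<close>, this is the plain intersection.
\<close>

definition Inter_in :: "'t set \<Rightarrow> 'i set \<Rightarrow> ('i \<Rightarrow> 't set) \<Rightarrow> 't set" where
  "Inter_in U I X = U \<inter> (\<Inter>i\<in>I. X i)"

definition Pr :: "'a set \<Rightarrow> 'a state trace set \<Rightarrow> 'a state trace set" where
  "Pr A X = X \<inter> inf_traces A"

definition Df :: "'a set \<Rightarrow> 'a state trace set \<Rightarrow> 'a state trace set" where
  "Df A P = dp A P"

end

theory Submission
  imports Defs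
begin

text \<open>
  A trace is definitive for \<open>X\<close> iff all its infinite extensions lie in \<open>X\<close>: every
  finite extension can be continued to an infinite one and is therefore automatically a prefix of
  a trace in \<open>X\<close>. So \<open>dp\<close> depends only on the infinite traces in its argument
  and does not change them, and each claim about bounds becomes one about sets of infinite traces.
\<close>

lemma conc_assoc: "(t \<cdot> u) \<cdot> v = t \<cdot> (u \<cdot> v)"
  by (cases t; cases u; cases v) auto

lemma inf_traces_conc: "t \<in> inf_traces A \<Longrightarrow> t \<cdot> u = t"
  by (auto simp: inf_traces_def)

lemma conc_in_traces: "t \<in> traces A \<Longrightarrow> u \<in> traces A \<Longrightarrow> t \<cdot> u \<in> traces A"
  by (fastforce simp: traces_def fin_traces_def inf_traces_def image_iff intro!: shift_streams)

lemma conc_in_inf_traces: "t \<in> traces A \<Longrightarrow> u \<in> inf_traces A \<Longrightarrow> t \<cdot> u \<in> inf_traces A"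
  by (auto simp: traces_def fin_traces_def inf_traces_def image_iff intro!: shift_streams)

lemma inf_traces_subset: "inf_traces A \<subseteq> traces A"
  by (simp add: traces_def)

text \<open>The state \<open>{}\<close> lies in \<open>Pow A\<close> even if \<open>A\<close> is
  empty, so every finite trace has an infinite continuation.\<close>

lemma inf_traces_nonempty: "inf_traces A \<noteq> {}"
proof -
  have "sconst {} \<in> streams (Pow A)"
    by (simp add: streams_iff_sset)
  then show ?thesis
    by (auto simp: inf_traces_def)
qed

lemma dp_iff_inf_extensions:
  "t \<in> dp A X \<longleftrightarrow> t \<in> traces A \<and> (\<forall>u\<in>inf_traces A. t \<cdot> u \<in> X)"
proof (intro iffI conjI ballI)
  assume t: "t \<in> dp A X"
  then show "t \<in> traces A"
    by (simp add: dp_def)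
  fix u assume u: "u \<in> inf_traces A"
  then have "t \<cdot> u \<in> prefixes A X"
    using t inf_traces_subset by (fastforce simp: dp_def extensions_def)
  then obtain v where "(t \<cdot> u) \<cdot> v \<in> X"
    by (auto simp: prefixes_def)
  \<comment> \<open>The trace \<open>t \<cdot> u\<close> is infinite and therefore absorbs
    \<open>v\<close>.\<close>
  then show "t \<cdot> u \<in> X"
    using inf_traces_conc[OF conc_in_inf_traces[OF \<open>t \<in> traces A\<close> u]] by simp
next
  assume t: "t \<in> traces A \<and> (\<forall>u\<in>inf_traces A. t \<cdot> u \<in> X)"
  obtain w where w: "w \<in> inf_traces A"
    using inf_traces_nonempty by blast
  have "t \<cdot> u \<in> prefixes A X" if u: "u \<in> traces A" for u
  proof -
    \<comment> \<open>By associativity this trace is \<open>t\<close> followed by the infinite trace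
      \<open>u \<cdot> w\<close>, so the assumption on \<open>t\<close> applies.\<close>
    have "(t \<cdot> u) \<cdot> w \<in> X"
      using t conc_in_inf_traces[OF u w] by (simp add: conc_assoc)
    then show ?thesis
      using t u w conc_in_traces inf_traces_subset unfolding prefixes_def by blast
  qed
  then show "t \<in> dp A X"
    using t by (auto simp: dp_def extensions_def)
qed

text \<open>An infinite trace is its own only extension; since some infinite \<open>u\<close>
  exists, the condition \<open>t \<cdot> u \<in> X\<close> reduces to
  \<open>t \<in> X\<close>.\<close>

lemma Pr_dp: "Pr A (dp A X) = Pr A X"
  using inf_traces_nonempty inf_traces_subset
  by (fastforce simp: Pr_def dp_iff_inf_extensions inf_traces_conc)

text \<open>Membership in \<open>dp A X\<close> tests only traces \<open>t \<cdot> u\<close> with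
  \<open>u\<close> infinite, and these are infinite themselves.\<close>

lemma dp_Pr: "dp A (Pr A X) = dp A X"
  by (auto simp: Pr_def dp_iff_inf_extensions conc_in_inf_traces)

lemma dp_cong_Pr: "Pr A X = Pr A Y \<Longrightarrow> dp A X = dp A Y"
  by (metis dp_Pr)

lemma Pr_UN: "Pr A (\<Union>i\<in>I. X i) = (\<Union>i\<in>I. Pr A (X i))"
  by (auto simp: Pr_def)

lemma Pr_Inter_in: "Pr A (Inter_in (traces A) I X) = Inter_in (inf_traces A) I (\<lambda>i. Pr A (X i))"
  using inf_traces_subset by (auto simp: Pr_def Inter_in_def)

lemma Pr_definitive_Union: "Pr A (definitive_Union A I X) = (\<Union>i\<in>I. Pr A (X i))"
  by (simp add: definitive_Union_def Pr_dp Pr_UN)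

lemma Df_definitive: "Df A P \<in> definitive_sets A"
proof -
  \<comment> \<open>Idempotence: \<open>dp A P\<close> and \<open>P\<close> have the same infinite
    traces.\<close>
  have "dp A (dp A P) = dp A P"
    by (intro dp_cong_Pr Pr_dp)
  then show ?thesis
    by (auto simp: Df_def definitive_sets_def dp_def)
qed

lemma Df_mono: "P \<subseteq> Q \<Longrightarrow> Df A P \<subseteq> Df A Q"
  by (fastforce simp: Df_def dp_iff_inf_extensions)

text \<open>The universal quantifiers over \<open>u\<close> and \<open>i\<close> commute. The bound
  \<open>inf_traces A\<close> holds for every \<open>t \<cdot> u\<close> with \<open>u\<close>
  infinite, so the empty family yields all of \<open>traces A\<close>.\<close>

lemma Df_Inter_in: "Df A (Inter_in (inf_traces A) I P) = Inter_in (traces A) I (\<lambda>i. Df A (P i))"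
  by (auto simp: Df_def Inter_in_def dp_iff_inf_extensions conc_in_inf_traces)

lemma Df_UN: "Df A (\<Union>i\<in>I. P i) = definitive_Union A I (\<lambda>i. Df A (P i))"
  unfolding Df_def definitive_Union_def
  \<comment> \<open>Replacing each \<open>P i\<close> by \<open>dp A (P i)\<close> may add finite
    traces to the union but leaves its infinite traces unchanged.\<close>
  by (rule dp_cong_Pr) (simp add: Pr_UN Pr_dp)

theorem theorem3:
  fixes A :: "'a set"
  shows
    "(Pr A \<in> definitive_sets A \<rightarrow> Pow (inf_traces A)) \<and>
     (\<forall>X\<in>definitive_sets A. \<forall>Y\<in>definitive_sets A. X \<subseteq> Y \<longrightarrow> Pr A X \<subseteq> Pr A Y) \<and>
     (\<forall>(I :: 'i set) X. (\<forall>i\<in>I. X i \<in> definitive_sets A) \<longrightarrow>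
        Pr A (Inter_in (traces A) I X) = Inter_in (inf_traces A) I (\<lambda>i. Pr A (X i))) \<and>
     (\<forall>(I :: 'i set) X. (\<forall>i\<in>I. X i \<in> definitive_sets A) \<longrightarrow>
        Pr A (definitive_Union A I X) = (\<Union>i\<in>I. Pr A (X i))) \<and>
     (Df A \<in> Pow (inf_traces A) \<rightarrow> definitive_sets A) \<and>
     (\<forall>P Q. P \<subseteq> inf_traces A \<longrightarrow> Q \<subseteq> inf_traces A \<longrightarrow> P \<subseteq> Q \<longrightarrow> Df A P \<subseteq> Df A Q) \<and>
     (\<forall>(I :: 'i set) P. (\<forall>i\<in>I. P i \<subseteq> inf_traces A) \<longrightarrow>
        Df A (Inter_in (inf_traces A) I P) = Inter_in (traces A) I (\<lambda>i. Df A (P i))) \<and>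
     (\<forall>(I :: 'i set) P. (\<forall>i\<in>I. P i \<subseteq> inf_traces A) \<longrightarrow>
        Df A (\<Union>i\<in>I. P i) = definitive_Union A I (\<lambda>i. Df A (P i)))"
proof (intro conjI allI impI ballI)
  show "Pr A \<in> definitive_sets A \<rightarrow> Pow (inf_traces A)"
    by (auto simp: Pr_def)
  show "Df A \<in> Pow (inf_traces A) \<rightarrow> definitive_sets A"
    by (simp add: Df_definitive)
qed (simp_all add: Pr_Inter_in Pr_definitive_Union Df_mono Df_Inter_in Df_UN, auto simp: Pr_def)

end
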